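(* Let $q\in\mathbb{N}$ and let $B_0$, $B_1$, and $B_{k,l}$ ($k\in\mathbb{N}$, $l\in\{1,\ldots,2^{k-1}\}$) be the blocks of functions on $[0,1]$ defined in the context. Then for all $k\in\mathbb{N}$ and all $l\in\{1,\ldots,2^{k-1}\}$, $$\langle B_0,B_{k,l}\rangle=0,$$ and for all $(k_1,k_2)\in\mathbb{N}^2$ with $k_1\ne k_2$ and all $(l_1,l_2)\in\{1,\ldots,2^{k_1-1}\}\times\{1,\ldots,2^{k_2-1}\}$, $$\langle B_{k_1,l_1},B_{k_2,l_2}\rangle=0.$$ Moreover, $\mathcal{V}_0=\mathrm{span}(B_0)$, and for all $k\in\mathbb{N}$, as subspaces of $L_2(\mu)$, $$\mathcal{V}_k=\mathrm{span}\Bigl(B_0,\ \bigl\{B_{k',l'}:\ k'\in\{1,\ldots,k\},\ l'\in\{1,\ldots,2^{k'-1}\}\bigr\}\Bigr),$$ where $$\mathcal{V}_k:=\mathrm{span}\Bigl(\bigl\{u\mapsto(u-(l-1)2^{-k})_+^{j-1}:\ j\in\{1,\ldots,q\},\ l\in\{1,\ldots,2^k\}\bigr\}\Bigr),\quad k\in\mathbb{N}_0.$$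
   Context: $\mu$ is Lebesgue measure on $[0,1]$; functions on $[0,1]$ are considered as elements of $L_2(\mu)$. $u_+:=\max\{u,0\}$ with the convention $u_+^0:=1$ if $u\ge0$ and $0$ if $u<0$. A block is a vector $F=(f_1,\ldots,f_{q})$ of functions on $[0,1]$; for two blocks $F,G$, $\langle F,G\rangle$ denotes the $q\times q$ matrix of inner products $\int f_i g_j\,d\mu$. The span of a block (or of several blocks) is the linear span of its (their) component functions. $B_0:=(b_1,\ldots,b_q)$ (a row vector of functions) with $b_j(u):=u^{j-1}$. $$B_{1,1}:=B_1:=B_0A_{1,1}\mathbf{1}_{[0,1/2)}+B_0A_{1,2}\mathbf{1}_{[1/2,1]},$$ where $A_{1,1},A_{1,2}\in\mathbb{R}^{q\times q}$ are matrices such that $\langle B_1,B_0\rangle=0$ and such that the $q$ component functions of $B_1$ are linearly independent. For $k\in\mathbb{N}$ and $l\in\{1,\ldots,2^{k-1}\}$, $$B_{k,l}(u):=B_1\bigl(2^{k-1}(u-(l-1)2^{-(k-1)})\bigr)\,\mathbf{1}\{(l-1)2^{-(k-1)}\le u<l2^{-(k-1)}\}.$$ *)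

theory Defs
  imports "HOL-Analysis.Analysis" "Jordan_Normal_Form.Matrix"
begin

unbundle no vec_syntax

abbreviation mu :: "real measure" where
  "mu \<equiv> lebesgue_on {0..1}"

definition square_integrable :: "(real \<Rightarrow> real) \<Rightarrow> bool" where
  "square_integrable f \<longleftrightarrow> f \<in> borel_measurable mu \<and> integrable mu (\<lambda>u. (f u)\<^sup>2)"

definition L2_rel :: "(real \<Rightarrow> real) \<Rightarrow> (real \<Rightarrow> real) \<Rightarrow> bool" where
  "L2_rel f g \<longleftrightarrow> square_integrable f \<and> square_integrable g \<and> (AE u in mu. f u = g u)"

lemma square_integrable_mult:
  assumes "square_integrable f" "square_integrable g"
  shows "integrable mu (\<lambda>u. f u * g u)"
proof (rule Bochner_Integration.integrable_bound)
  show "integrable mu (\<lambda>u. (f u)\<^sup>2 + (g u)\<^sup>2)"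
    using assms by (auto simp: square_integrable_def)
  show "(\<lambda>u. f u * g u) \<in> borel_measurable mu"
    using assms by (auto simp: square_integrable_def)
  have "\<bar>x * y\<bar> \<le> x\<^sup>2 + y\<^sup>2" for x y :: real
  proof -
    have "0 \<le> (\<bar>x\<bar> - \<bar>y\<bar>)\<^sup>2" by simp
    then have "2 * (\<bar>x\<bar> * \<bar>y\<bar>) \<le> x\<^sup>2 + y\<^sup>2" by (simp add: power2_diff)
    moreover have "0 \<le> \<bar>x\<bar> * \<bar>y\<bar>" by simp
    ultimately show ?thesis unfolding abs_mult by linarith
  qed
  then show "AE u in mu. norm (f u * g u) \<le> norm ((f u)\<^sup>2 + (g u)\<^sup>2)" by simp
qed

lemma square_integrable_0 [simp]: "square_integrable (\<lambda>_. 0)"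
  by (simp add: square_integrable_def)

lemma square_integrable_add:
  assumes "square_integrable f" "square_integrable g"
  shows "square_integrable (\<lambda>u. f u + g u)"
  using assms square_integrable_mult[OF assms]
  by (auto simp: square_integrable_def power2_sum mult.assoc)

lemma square_integrable_scale:
  "square_integrable f \<Longrightarrow> square_integrable (\<lambda>u. c * f u)"
  by (auto simp: square_integrable_def power_mult_distrib)

lemma square_integrable_uminus:
  "square_integrable f \<Longrightarrow> square_integrable (\<lambda>u. - f u)"
  using square_integrable_scale[of f "-1"] by simp

lemma square_integrable_diff:
  "square_integrable f \<Longrightarrow> square_integrable g \<Longrightarrow> square_integrable (\<lambda>u. f u - g u)"
  using square_integrable_add[OF _ square_integrable_uminus, of f g] by simp

quotient_type L2 = "real \<Rightarrow> real" / partial: L2_rel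
proof (rule part_equivpI)
  show "\<exists>f. L2_rel f f"
    by (rule exI[of _ "\<lambda>_. 0"]) (simp add: L2_rel_def)
  show "symp L2_rel"
    by (auto simp: L2_rel_def symp_def)
  show "transp L2_rel"
    by (auto simp: L2_rel_def transp_def)
qed

instantiation L2 :: real_inner
begin

lift_definition zero_L2 :: L2 is "\<lambda>_. 0"
  by (simp add: L2_rel_def)

lift_definition plus_L2 :: "L2 \<Rightarrow> L2 \<Rightarrow> L2" is "\<lambda>f g u. f u + g u"
  by (auto simp: L2_rel_def square_integrable_add)

lift_definition uminus_L2 :: "L2 \<Rightarrow> L2" is "\<lambda>f u. - f u"
  by (auto simp: L2_rel_def square_integrable_uminus)

lift_definition minus_L2 :: "L2 \<Rightarrow> L2 \<Rightarrow> L2" is "\<lambda>f g u. f u - g u"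
  by (auto simp: L2_rel_def square_integrable_diff)

lift_definition scaleR_L2 :: "real \<Rightarrow> L2 \<Rightarrow> L2" is "\<lambda>c f u. c * f u"
  by (auto simp: L2_rel_def square_integrable_scale)

lift_definition inner_L2 :: "L2 \<Rightarrow> L2 \<Rightarrow> real" is "\<lambda>f g. \<integral>u. f u * g u \<partial>mu"
proof -
  fix f f' g g' assume "L2_rel f f'" "L2_rel g g'"
  then show "(\<integral>u. f u * g u \<partial>mu) = (\<integral>u. f' u * g' u \<partial>mu)"
    by (intro integral_cong_AE) (auto simp: L2_rel_def square_integrable_def)
qed

definition norm_L2 :: "L2 \<Rightarrow> real" where
  "norm_L2 x = sqrt (inner x x)"

definition sgn_L2 :: "L2 \<Rightarrow> L2" where
  "sgn_L2 x = scaleR (inverse (norm x)) x"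

definition dist_L2 :: "L2 \<Rightarrow> L2 \<Rightarrow> real" where
  "dist_L2 x y = norm (x - y)"

definition uniformity_L2 :: "(L2 \<times> L2) filter" where
  "uniformity_L2 = (INF e\<in>{0<..}. principal {(x, y). dist x y < e})"

definition open_L2 :: "L2 set \<Rightarrow> bool" where
  "open_L2 U \<longleftrightarrow> (\<forall>x\<in>U. eventually (\<lambda>(x', y). x' = x \<longrightarrow> y \<in> U) uniformity)"

instance
proof
  fix x y z :: L2 and a b r :: real and U :: "L2 set"
  show "x + y + z = x + (y + z)"
    by transfer (auto simp: L2_rel_def square_integrable_add add.assoc)
  show "x + y = y + x"
    by transfer (auto simp: L2_rel_def square_integrable_add add.commute)
  show "0 + x = x"
    by transfer (auto simp: L2_rel_def)
  show "- x + x = 0"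
    by transfer (auto simp: L2_rel_def)
  show "x - y = x + - y"
    by transfer (auto simp: L2_rel_def square_integrable_diff)
  show "a *\<^sub>R (x + y) = a *\<^sub>R x + a *\<^sub>R y"
    by transfer (auto simp: L2_rel_def square_integrable_add square_integrable_scale distrib_left)
  show "(a + b) *\<^sub>R x = a *\<^sub>R x + b *\<^sub>R x"
    by transfer (auto simp: L2_rel_def square_integrable_add square_integrable_scale distrib_right)
  show "a *\<^sub>R b *\<^sub>R x = (a * b) *\<^sub>R x"
    by transfer (auto simp: L2_rel_def square_integrable_scale mult.assoc)
  show "1 *\<^sub>R x = x"
    by transfer (auto simp: L2_rel_def)
  show "inner x y = inner y x"
    by transfer (simp add: mult.commute)
  show "inner (x + y) z = inner x z + inner y z"
    by transfer (auto simp: L2_rel_def distrib_right square_integrable_mult)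
  show "inner (r *\<^sub>R x) y = r * inner x y"
    by transfer (simp add: mult.assoc)
  show "0 \<le> inner x x"
    by transfer simp
  show "inner x x = 0 \<longleftrightarrow> x = 0"
  proof transfer
    fix f assume "L2_rel f f"
    then have f: "square_integrable f" by (simp add: L2_rel_def)
    have "(\<integral>u. f u * f u \<partial>mu) = 0 \<longleftrightarrow> (AE u in mu. f u * f u = 0)"
      by (rule integral_nonneg_eq_0_iff_AE) (auto intro: square_integrable_mult f)
    then show "(\<integral>u. f u * f u \<partial>mu) = 0 \<longleftrightarrow> L2_rel f (\<lambda>_. 0)"
      using f by (simp add: L2_rel_def)
  qed
qed (simp_all add: norm_L2_def sgn_L2_def dist_L2_def uniformity_L2_def open_L2_def)

end

text \<open>The default value 0 for functions that are not square-integrable is never used below: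
  see \<open>square_integrable_B0\<close>, \<open>square_integrable_B1\<close>, \<open>square_integrable_Bkl\<close> and
  \<open>square_integrable_tpow\<close>.\<close>

lift_definition L2_class :: "(real \<Rightarrow> real) \<Rightarrow> L2" is
  "\<lambda>f. if square_integrable f then f else (\<lambda>_. 0)"
  by (simp add: L2_rel_def)

lemma inner_L2_class:
  "square_integrable f \<Longrightarrow> square_integrable g \<Longrightarrow>
    inner (L2_class f) (L2_class g) = (\<integral>u. f u * g u \<partial>mu)"
  by transfer simp

lemma L2_class_eq_iff:
  "square_integrable f \<Longrightarrow> square_integrable g \<Longrightarrow>
    L2_class f = L2_class g \<longleftrightarrow> (AE u in mu. f u = g u)"
  by transfer (simp add: L2_rel_def)


text \<open>The components of a block \<open>F\<close> of length \<open>q\<close> are \<open>F $ 0, \<dots>, F $ (q - 1)\<close>, so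
  indices of components are shifted by one against the usual numbering.\<close>

type_synonym block = "(real \<Rightarrow> real) vec"

definition gram :: "block \<Rightarrow> block \<Rightarrow> real mat" where
  "gram F G = mat (dim_vec F) (dim_vec G) (\<lambda>(i, j). \<integral>u. (F $ i) u * (G $ j) u \<partial>mu)"

definition block_span :: "block set \<Rightarrow> L2 set" where
  "block_span \<F> = span (\<Union>F\<in>\<F>. L2_class ` set\<^sub>v F)"

definition lin_indep_block :: "block \<Rightarrow> bool" where
  "lin_indep_block F \<longleftrightarrow>
    inj_on (\<lambda>j. L2_class (F $ j)) {..<dim_vec F} \<and> independent (L2_class ` set\<^sub>v F)"

definition block_mult :: "block \<Rightarrow> real mat \<Rightarrow> block" where
  "block_mult F A =
    vec (dim_col A) (\<lambda>j u. \<Sum>i<dim_vec F. (F $ i) u * A $$ (i, j))"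

definition B0 :: "nat \<Rightarrow> block" where
  "B0 q = vec q (\<lambda>j u. u ^ j)"

definition B1 :: "nat \<Rightarrow> real mat \<Rightarrow> real mat \<Rightarrow> block" where
  "B1 q A1 A2 = vec q (\<lambda>j u.
      (block_mult (B0 q) A1 $ j) u * indicator {0..<1/2} u
    + (block_mult (B0 q) A2 $ j) u * indicator {1/2..1} u)"

text \<open>Only used for \<open>k \<ge> 1\<close> and \<open>1 \<le> l \<le> 2 ^ (k - 1)\<close>. The component functions of
  \<open>Bkl q A1 A2 1 1\<close> and \<open>B1 q A1 A2\<close> may differ at the point 1, where the former vanish;
  their classes in \<^typ>\<open>L2\<close> agree (lemma \<open>Bkl_1_1\<close>).\<close>

definition Bkl :: "nat \<Rightarrow> real mat \<Rightarrow> real mat \<Rightarrow> nat \<Rightarrow> nat \<Rightarrow> block" where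
  "Bkl q A1 A2 k l = vec q (\<lambda>j u.
      (B1 q A1 A2 $ j) (2 ^ (k - 1) * (u - (real l - 1) / 2 ^ (k - 1)))
      * indicator {(real l - 1) / 2 ^ (k - 1)..<real l / 2 ^ (k - 1)} u)"

lemma AE_mu_neq: "AE u in mu. u \<noteq> c"
proof -
  have "AE u in lebesgue. u \<noteq> c"
    by (rule AE_I'[of "{c}"]) auto
  then show ?thesis
    by (subst AE_restrict_space_iff) auto
qed

lemma Bkl_1_1_AE:
  assumes "j < q"
  shows "AE u in mu. (Bkl q A1 A2 1 1 $ j) u = (B1 q A1 A2 $ j) u"
  using AE_mu_neq[of 1] AE_space
proof eventually_elim
  case (elim u)
  then have "u \<in> {0..<1}" by (auto simp: space_restrict_space)
  then show ?case using assms by (simp add: Bkl_def)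
qed

lemma square_integrable_bounded:
  assumes "f \<in> borel_measurable borel" "\<And>u. u \<in> {0..1} \<Longrightarrow> \<bar>f u\<bar> \<le> C"
  shows "square_integrable f"
proof -
  have m: "f \<in> borel_measurable mu"
    using assms(1) by (intro measurable_restrict_space1) (simp add: measurable_completion)
  interpret finite_measure mu
    by (rule finite_measureI) (simp add: emeasure_restrict_space)
  have "integrable mu (\<lambda>u. (f u)\<^sup>2)"
  proof (rule integrable_const_bound[of _ "C\<^sup>2"])
    show "AE u in mu. norm ((f u)\<^sup>2) \<le> C\<^sup>2"
      using assms(2) by (intro AE_I2) (auto simp: space_restrict_space abs_le_square_iff
        dest!: assms(2) intro!: power2_le_iff_abs_le[THEN iffD2] order.trans[OF abs_ge_zero])
  qed (use m in simp)
  with m show ?thesis by (simp add: square_integrable_def)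
qed

lemma square_integrable_B0:
  assumes "j < q"
  shows "square_integrable (B0 q $ j)"
  by (rule square_integrable_bounded[where C = 1]) (use assms in \<open>auto simp: B0_def power_le_one\<close>)

lemma block_mult_B0:
  assumes "A \<in> carrier_mat q q" "j < q"
  shows "(block_mult (B0 q) A $ j) u = (\<Sum>i<q. u ^ i * A $$ (i, j))"
  using assms by (auto simp: block_mult_def B0_def)

lemma B1_measurable:
  assumes "A1 \<in> carrier_mat q q" "A2 \<in> carrier_mat q q" "j < q"
  shows "B1 q A1 A2 $ j \<in> borel_measurable borel"
  using assms by (simp add: B1_def block_mult_B0)

lemma B1_bounded:
  assumes "A1 \<in> carrier_mat q q" "A2 \<in> carrier_mat q q" "j < q"
  shows "\<bar>(B1 q A1 A2 $ j) u\<bar> \<le> (\<Sum>i<q. \<bar>A1 $$ (i, j)\<bar>) + (\<Sum>i<q. \<bar>A2 $$ (i, j)\<bar>)"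
proof -
  have bd: "\<bar>(\<Sum>i<q. u ^ i * A $$ (i, j)) * indicator S u\<bar> \<le> (\<Sum>i<q. \<bar>A $$ (i, j)\<bar>)"
    if "S \<subseteq> {0..1}" for A :: "real mat" and S
  proof (cases "u \<in> S")
    case True
    with that have u: "0 \<le> u" "u \<le> 1" by auto
    have "\<bar>\<Sum>i<q. u ^ i * A $$ (i, j)\<bar> \<le> (\<Sum>i<q. \<bar>u ^ i * A $$ (i, j)\<bar>)"
      by (rule sum_abs)
    also have "\<dots> \<le> (\<Sum>i<q. \<bar>A $$ (i, j)\<bar>)"
      using u by (intro sum_mono) (auto simp: abs_mult power_le_one intro!: mult_left_le_one_le)
    finally show ?thesis using True by simp
  qed (simp add: sum_nonneg)
  have "{0..<1/2} \<subseteq> {0..1::real}" "{1/2..1} \<subseteq> {0..1::real}" by auto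
  from this[THEN bd] show ?thesis
    using assms unfolding B1_def
    by (simp add: block_mult_B0) (meson abs_triangle_ineq add_mono order_trans)
qed

lemma square_integrable_B1:
  assumes "A1 \<in> carrier_mat q q" "A2 \<in> carrier_mat q q" "j < q"
  shows "square_integrable (B1 q A1 A2 $ j)"
  by (rule square_integrable_bounded[OF B1_measurable B1_bounded]) (use assms in auto)

lemma square_integrable_Bkl:
  assumes "A1 \<in> carrier_mat q q" "A2 \<in> carrier_mat q q" "j < q"
  shows "square_integrable (Bkl q A1 A2 k l $ j)"
proof (rule square_integrable_bounded)
  show "Bkl q A1 A2 k l $ j \<in> borel_measurable borel"
    using assms
    by (simp add: Bkl_def) (intro borel_measurable_times measurable_compose[OF _ B1_measurable]; simp)
  show "\<bar>(Bkl q A1 A2 k l $ j) u\<bar>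
      \<le> (\<Sum>i<q. \<bar>A1 $$ (i, j)\<bar>) + (\<Sum>i<q. \<bar>A2 $$ (i, j)\<bar>)" for u
    using assms B1_bounded[OF assms]
    by (auto simp: Bkl_def indicator_def sum_nonneg)
qed

lemma Bkl_1_1:
  assumes "A1 \<in> carrier_mat q q" "A2 \<in> carrier_mat q q" "j < q"
  shows "L2_class (Bkl q A1 A2 1 1 $ j) = L2_class (B1 q A1 A2 $ j)"
  using assms
  by (simp only: L2_class_eq_iff square_integrable_B1 square_integrable_Bkl Bkl_1_1_AE)

text \<open>The case \<open>n = 0\<close> is separate because \<open>0 ^ 0 = 1\<close> would give 1 also for \<open>u < 0\<close>.\<close>

definition tpow :: "real \<Rightarrow> nat \<Rightarrow> real" where
  "tpow u n = (if n = 0 then (if u \<ge> 0 then 1 else 0) else (max u 0) ^ n)"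

lemma square_integrable_tpow:
  assumes "a \<ge> 0"
  shows "square_integrable (\<lambda>u. tpow (u - a) n)"
proof (rule square_integrable_bounded)
  show "(\<lambda>u. tpow (u - a) n) \<in> borel_measurable borel"
    unfolding tpow_def by measurable
  show "\<bar>tpow (u - a) n\<bar> \<le> 1" if "u \<in> {0..1}" for u
    using that assms by (auto simp: tpow_def power_le_one)
qed

definition V :: "nat \<Rightarrow> nat \<Rightarrow> L2 set" where
  "V q k = span {L2_class (\<lambda>u. tpow (u - (real l - 1) / 2 ^ k) (j - 1)) | j l.
     j \<in> {1..q} \<and> l \<in> {1..2 ^ k}}"

end

theory Submission
  imports Defs
begin

text \<open>
  The proof rests on the self-similarity of the dyadic grid. Write \<open>dilate k l\<close> for the linear
  operator on \<^typ>\<open>L2\<close> that shrinks a function by the factor \<open>2 ^ k\<close>, places the copy on the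
  \<open>l\<close>-th dyadic interval of length \<open>1 / 2 ^ k\<close>, and extends it by \<open>0\<close>. It multiplies inner
  products by \<open>1 / 2 ^ k\<close>, copies on different intervals of the same level are orthogonal, and
  copies of copies are copies of a finer level (\<open>inner_dilate\<close>, \<open>inner_dilate_disjoint\<close>,
  \<open>dilate_dilate\<close>). The components of \<open>Bkl q A1 A2 (k + 1) l\<close> are the copies, under
  \<open>dilate k l\<close>, of the components of \<open>B1 q A1 A2\<close>.

  The space \<open>V q k\<close>, defined through truncated powers, consists of all piecewise polynomials of
  degree less than \<open>q\<close> on the grid of level \<open>k\<close>; that is, it is spanned by the copies
  \<open>dilate k l (mon j)\<close> of monomials (\<open>V_eq_span_dilate\<close>). In particular \<open>V q k\<close> grows with
  \<open>k\<close>, and \<open>V q 0\<close> is the space of polynomials of degree less than \<open>q\<close>.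

  Orthogonality: a function orthogonal to all these polynomials has copies \<open>dilate k l\<close> orthogonal to
  \<open>V q k\<close>, since on the interval that carries the copy every element of \<open>V q k\<close> is itself a copy
  of a polynomial (\<open>inner_V_dilate\<close>). This applies to the components of \<open>B1\<close>. As \<open>V q k\<close>
  contains the polynomials and all blocks of levels up to \<open>k\<close>, it covers both orthogonality
  claims.

  Spanning: the components of \<open>B0\<close> and \<open>B1\<close> are \<open>2 * q\<close> elements of \<open>V q 1\<close>, linearly
  independent because each block is and the two are orthogonal. As \<open>V q 1\<close> is spanned by \<open>2 * q\<close> elements, they span it (\<open>V_1_eq_span\<close>). Applying
  \<open>dilate k l\<close> to this identity, for every \<open>l\<close>, says that \<open>V q (k + 1)\<close> is spanned by
  \<open>V q k\<close> and the blocks of level \<open>k + 1\<close> (\<open>V_Suc\<close>), and induction on \<open>k\<close> finishes the proof.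
\<close>

section \<open>Linear algebra\<close>

text \<open>A dimension count: if \<open>span S\<close> missed an element of \<open>T\<close>, adding it to \<open>S\<close> would give more
  independent vectors in \<open>span T\<close> than \<open>T\<close> has elements. No finiteness of the ambient dimension
  is involved, so it applies in \<^typ>\<open>L2\<close>.\<close>

lemma span_eq_if_independent_card_ge:
  fixes S T :: "'a::real_vector set"
  assumes "independent S" "finite T" "S \<subseteq> span T" "card T \<le> card S"
  shows "span S = span T"
proof
  show "span S \<subseteq> span T"
    using assms(3) by (simp add: span_minimal)
  have fS: "finite S" "card S \<le> card T"
    using independent_span_bound[OF assms(2,1,3)] by auto
  have "T \<subseteq> span S"
  proof
    fix x assume "x \<in> T"
    show "x \<in> span S"
    proof (rule ccontr)
      assume x: "x \<notin> span S"
      then have "independent (insert x S)" "x \<notin> S"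
        using assms(1) by (auto simp: independent_insert span_base)
      moreover have "insert x S \<subseteq> span T"
        using assms(3) \<open>x \<in> T\<close> by (auto simp: span_base)
      ultimately have "card (insert x S) \<le> card T"
        using independent_span_bound[OF assms(2)] by blast
      with assms(4) fS \<open>x \<notin> S\<close> show False by simp
    qed
  qed
  then show "span T \<subseteq> span S"
    by (simp add: span_minimal)
qed

text \<open>If a linear combination vanishes, its parts in \<open>span S\<close> and in \<open>span T\<close> are orthogonal and
  opposite to each other, so both vanish.\<close>

lemma independent_orthogonal_Un:
  fixes S T :: "'a::real_inner set"
  assumes "independent S" "independent T"
    and orth: "\<And>x y. x \<in> S \<Longrightarrow> y \<in> T \<Longrightarrow> inner x y = 0"
  shows "independent (S \<union> T)" "S \<inter> T = {}"
proof -
  show "S \<inter> T = {}"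
  proof (rule ccontr)
    assume "S \<inter> T \<noteq> {}"
    then obtain x where "x \<in> S" "x \<in> T" by blast
    with orth have "inner x x = 0" by blast
    then have "0 \<in> S" using \<open>x \<in> S\<close> by simp
    with assms(1) show False using dependent_zero by blast
  qed
  show "independent (S \<union> T)"
    unfolding independent_explicit_finite_subsets
  proof (intro allI impI ballI)
    fix U u v
    assume U: "U \<subseteq> S \<union> T" "finite U" "(\<Sum>w\<in>U. u w *\<^sub>R w) = 0" "v \<in> U"
    define a where "a = (\<Sum>w\<in>U \<inter> S. u w *\<^sub>R w)"
    define b where "b = (\<Sum>w\<in>U - S. u w *\<^sub>R w)"
    have ab: "a + b = 0"
      using U(2,3) unfolding a_def b_def by (simp flip: sum.Int_Diff)
    have "inner a b = 0"
      unfolding a_def b_def using orth U(1)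
      by (auto simp: inner_sum_left inner_sum_right intro!: sum.neutral)
    moreover have "inner a (a + b) = 0"
      using ab by simp
    ultimately have "a = 0"
      by (simp add: inner_add_right)
    with ab have "b = 0" by simp
    show "u v = 0"
    proof (cases "v \<in> S")
      case True
      then show ?thesis
        using assms(1) \<open>a = 0\<close> U unfolding independent_explicit_finite_subsets a_def
        by (metis Int_iff Int_lower2 finite_Int)
    next
      case False
      have "U - S \<subseteq> T" using U(1) by blast
      then show ?thesis
        using assms(2) \<open>b = 0\<close> U False unfolding independent_explicit_finite_subsets b_def
        by (metis Diff_iff finite_Diff)
    qed
  qed
qed

section \<open>Monomials in \<open>L2\<close>\<close>

lemma L2_class_add:
  "square_integrable f \<Longrightarrow> square_integrable g \<Longrightarrow>
    L2_class (\<lambda>u. f u + g u) = L2_class f + L2_class g"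
  by transfer (simp add: L2_rel_def square_integrable_add)

lemma L2_class_scale:
  "square_integrable f \<Longrightarrow> L2_class (\<lambda>u. c * f u) = c *\<^sub>R L2_class f"
  by transfer (simp add: L2_rel_def square_integrable_scale)

lemma L2_class_zero: "L2_class (\<lambda>_. 0) = 0"
  by transfer (simp add: L2_rel_def)

lemma square_integrable_sum:
  "(\<And>i. i \<in> I \<Longrightarrow> square_integrable (f i)) \<Longrightarrow> square_integrable (\<lambda>u. \<Sum>i\<in>I. f i u)"
  by (induction I rule: infinite_finite_induct) (simp_all add: square_integrable_add)

lemma L2_class_sum:
  "(\<And>i. i \<in> I \<Longrightarrow> square_integrable (f i)) \<Longrightarrow>
    L2_class (\<lambda>u. \<Sum>i\<in>I. f i u) = (\<Sum>i\<in>I. L2_class (f i))"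
  by (induction I rule: infinite_finite_induct)
    (simp_all add: L2_class_zero L2_class_add square_integrable_sum)

lemma square_integrable_power: "square_integrable (\<lambda>u. u ^ i)"
  by (rule square_integrable_bounded[where C = 1]) (auto simp: power_le_one)

definition mon :: "nat \<Rightarrow> L2" where
  "mon i = L2_class (\<lambda>u. u ^ i)"

text \<open>A nonzero polynomial has only finitely many roots. They form a null set, so it does not vanish
  almost everywhere on \<open>[0, 1]\<close>.\<close>

lemma sum_monom_eq_0D:
  assumes "(\<Sum>i<q. c i *\<^sub>R mon i) = 0" "i < q"
  shows "c i = 0"
proof (rule ccontr)
  assume "c i \<noteq> 0"
  obtain n where q: "q = Suc n" using assms(2) by (cases q) auto
  let ?p = "\<lambda>u::real. \<Sum>i\<le>n. c i * u ^ i"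
  have "finite {u. ?p u = 0}"
    using \<open>c i \<noteq> 0\<close> assms(2) q by (subst polyfun_finite_roots) (auto simp: less_Suc_eq_le)
  then have "negligible {u. ?p u = 0}"
    by (rule negligible_finite)
  then have nz: "AE u in mu. ?p u \<noteq> 0"
    by (subst AE_restrict_space_iff)
      (auto simp: negligible_iff_null_sets intro!: AE_I'[of "{u. ?p u = 0}"])
  have "L2_class ?p = 0"
    using assms(1)
    by (simp add: q lessThan_Suc_atMost mon_def L2_class_sum L2_class_scale
        square_integrable_scale square_integrable_power)
  then have "L2_class ?p = L2_class (\<lambda>_. 0)"
    by (simp add: L2_class_zero)
  then have "AE u in mu. ?p u = 0"
    by (subst (asm) L2_class_eq_iff)
      (simp_all add: square_integrable_sum square_integrable_scale square_integrable_power)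
  with nz have "AE u in mu. False"
    by eventually_elim simp
  then have "emeasure mu (space mu) = 0"
    by (rule AE_iff_measurable[THEN iffD1, rotated 2]) auto
  then show False
    by (simp add: emeasure_restrict_space space_restrict_space)
qed

lemma inj_on_monom: "inj_on mon {..<q}"
proof (rule inj_onI, rule ccontr)
  fix i j assume ij: "i \<in> {..<q}" "j \<in> {..<q}" "mon i = mon j" "i \<noteq> j"
  define c :: "nat \<Rightarrow> real" where "c m = of_bool (m = i) - of_bool (m = j)" for m
  have "(\<Sum>m<q. of_bool (m = n) *\<^sub>R mon m) = mon n" if "n \<in> {..<q}" for n
    using that by (simp add: of_bool_def if_distrib[of "\<lambda>a. a *\<^sub>R _"] cong: if_cong)
  then have "(\<Sum>m<q. c m *\<^sub>R mon m) = 0"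
    using ij by (simp add: c_def scaleR_left_diff_distrib sum_subtractf)
  then have "c i = 0"
    using sum_monom_eq_0D ij(1) by blast
  with ij(4) show False by (simp add: c_def)
qed

lemma independent_monom: "independent (mon ` {..<q})"
proof (rule independent_if_scalars_zero)
  fix c x assume c: "(\<Sum>x\<in>mon ` {..<q}. c x *\<^sub>R x) = 0" and x: "x \<in> mon ` {..<q}"
  have "(\<Sum>i<q. c (mon i) *\<^sub>R mon i) = 0"
    using c by (simp add: sum.reindex inj_on_monom)
  then show "c x = 0"
    using x sum_monom_eq_0D[of "\<lambda>i. c (mon i)"] by auto
qed simp

section \<open>Scaled copies on dyadic intervals\<close>

text \<open>The integrals over \<open>[0, 1]\<close> become integrals over the real line, where the behaviour of
  Lebesgue measure under affine maps is known.\<close>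

lemma square_integrable_iff:
  "square_integrable f \<longleftrightarrow>
    (\<lambda>u. f u * indicator {0..1} u) \<in> borel_measurable lebesgue \<and>
    integrable lebesgue (\<lambda>u. (f u * indicator {0..1} u)\<^sup>2)"
proof -
  have "(\<lambda>u. indicator {0..1} u *\<^sub>R f u) = (\<lambda>u. f u * indicator {0..1} u)"
    "(\<lambda>u. indicator {0..1} u *\<^sub>R (f u)\<^sup>2) = (\<lambda>u. (f u * indicator {0..1} u)\<^sup>2)"
    by (auto simp: indicator_def)
  then show ?thesis
    unfolding square_integrable_def
    by (subst borel_measurable_restrict_space_iff, simp, subst integrable_restrict_space, simp, metis)
qed

abbreviation cell :: "nat \<Rightarrow> nat \<Rightarrow> real set" where
  "cell k l \<equiv> {(real l - 1) / 2 ^ k..<real l / 2 ^ k}"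

text \<open>The argument of \<open>f\<close> has the form used in \<^const>\<open>Bkl\<close>, so that the components of
  \<^const>\<open>Bkl\<close> are instances by mere unfolding.\<close>

definition dilate_fun :: "nat \<Rightarrow> nat \<Rightarrow> (real \<Rightarrow> real) \<Rightarrow> real \<Rightarrow> real" where
  "dilate_fun k l f u = f (2 ^ k * (u - (real l - 1) / 2 ^ k)) * indicator (cell k l) u"

lemma mem_cell_iff:
  "u \<in> cell k l \<longleftrightarrow> 2 ^ k * (u - (real l - 1) / 2 ^ k) \<in> {0..<1}"
proof -
  have "2 ^ k * (u - (real l - 1) / 2 ^ k) = 2 ^ k * u - (real l - 1)"
    unfolding right_diff_distrib by simp
  then show ?thesis
    by (auto simp: pos_divide_le_eq pos_less_divide_eq mult.commute)
qed

lemma borel_measurable_lebesgue_affine: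
  fixes f :: "real \<Rightarrow> real"
  assumes "f \<in> borel_measurable lebesgue"
  shows "(\<lambda>u. f (2 ^ k * (u - t))) \<in> borel_measurable lebesgue"
proof -
  have "(\<lambda>u::real. - (2 ^ k * t) + 2 ^ k * u) \<in> lebesgue \<rightarrow>\<^sub>M lebesgue"
    using lebesgue_affine_measurable[of "\<lambda>_. 2 ^ k" "- (2 ^ k * t)"] by simp
  from measurable_compose[OF this assms] show ?thesis
    by (simp add: algebra_simps)
qed

lemma square_integrable_dilate_fun:
  assumes "square_integrable f"
  shows "square_integrable (dilate_fun k l f)"
proof -
  define t where "t = (real l - 1) / 2 ^ k"
  define g where "g u = f u * indicator {0..1} u" for u
  have g: "g \<in> borel_measurable lebesgue" "integrable lebesgue (\<lambda>u. (g u)\<^sup>2)"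
    using assms unfolding square_integrable_iff g_def by auto
  \<comment> \<open>Restricting \<open>f\<close> to \<open>[0, 1]\<close> is harmless: on the cell, its argument lies in \<open>[0, 1)\<close>.\<close>
  have eq: "dilate_fun k l f u = g (2 ^ k * (u - t)) * indicator (cell k l) u" for u
    unfolding dilate_fun_def g_def t_def using mem_cell_iff[of u l k] by (auto simp: indicator_def)
  have m: "(\<lambda>u. g (2 ^ k * (u - t))) \<in> borel_measurable lebesgue"
    by (rule borel_measurable_lebesgue_affine[OF g(1)])
  have "integrable lebesgue (\<lambda>u. (g (- (2 ^ k * t) + 2 ^ k * u))\<^sup>2)"
    using g(2) lebesgue_integrable_real_affine_iff[of "2 ^ k" "\<lambda>u. (g u)\<^sup>2" "- (2 ^ k * t)"] by simp
  then have i: "integrable lebesgue (\<lambda>u. (g (2 ^ k * (u - t)))\<^sup>2)"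
    by (simp add: algebra_simps)
  show ?thesis
    unfolding square_integrable_iff eq
  proof
    show m': "(\<lambda>u. g (2 ^ k * (u - t)) * indicator (cell k l) u * indicator {0..1} u)
        \<in> borel_measurable lebesgue"
      using m by (intro borel_measurable_times borel_measurable_indicator) auto
    show "integrable lebesgue
        (\<lambda>u. (g (2 ^ k * (u - t)) * indicator (cell k l) u * indicator {0..1} u)\<^sup>2)"
      by (rule Bochner_Integration.integrable_bound[OF i borel_measurable_power[OF m']])
        (auto simp: indicator_def)
  qed
qed

lemma cell_subset:
  assumes "l \<in> {1..2 ^ k}"
  shows "cell k l \<subseteq> {0..1}"
proof -
  have "real l \<le> 2 ^ k" using assms of_nat_mono[of l "2 ^ k"] by simp
  then have "real l / 2 ^ k \<le> 1" by simp
  moreover have "0 \<le> (real l - 1) / 2 ^ k" using assms by simp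
  ultimately show ?thesis
    unfolding subset_iff atLeastLessThan_iff atLeastAtMost_iff by linarith
qed

text \<open>This is the substitution \<open>v = 2 ^ k * u - (l - 1)\<close>. The hypothesis on \<open>l\<close> ensures that the
  copy lies inside \<open>[0, 1]\<close> entirely. It lives on a half-open interval, which costs the
  null set \<open>{1}\<close>.\<close>

lemma integral_dilate_fun_times:
  assumes "l \<in> {1..2 ^ k}" "square_integrable f" "square_integrable g"
  shows "(\<integral>u. dilate_fun k l f u * dilate_fun k l g u \<partial>mu) = (\<integral>u. f u * g u \<partial>mu) / 2 ^ k"
proof -
  define t where "t = (real l - 1) / 2 ^ k"
  define h where "h u = f u * g u * indicator {0..<1} u" for u
  have "(\<integral>u. dilate_fun k l f u * dilate_fun k l g u \<partial>mu) =
      (\<integral>u. h (- (2 ^ k * t) + 2 ^ k * u) \<partial>lebesgue)"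
  proof -
    have I: "{0..1} \<inter> space lebesgue \<in> sets (lebesgue :: real measure)" by simp
    show ?thesis
      unfolding integral_restrict_space[OF I]
    proof (rule Bochner_Integration.integral_cong[OF refl])
      fix u :: real
      have "- (2 ^ k * t) + 2 ^ k * u = 2 ^ k * (u - t)" by (simp add: algebra_simps)
      then show "indicator {0..1} u *\<^sub>R (dilate_fun k l f u * dilate_fun k l g u) =
          h (- (2 ^ k * t) + 2 ^ k * u)"
        using mem_cell_iff[of u l k] cell_subset[OF assms(1)]
        by (auto simp: dilate_fun_def h_def t_def indicator_def)
    qed
  qed
  also have "\<dots> = (\<integral>u. h u \<partial>lebesgue) / 2 ^ k"
    using lebesgue_integral_real_affine[of "2 ^ k" h "- (2 ^ k * t)"] by simp
  also have "(\<integral>u. h u \<partial>lebesgue) = (\<integral>u. f u * g u * indicator {0..<1} u \<partial>mu)"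
    by (subst integral_restrict_space)
      (auto simp: h_def indicator_def intro!: Bochner_Integration.integral_cong)
  also have "\<dots> = (\<integral>u. f u * g u \<partial>mu)"
  proof (rule integral_cong_AE)
    show fg: "(\<lambda>u. f u * g u) \<in> borel_measurable mu"
      using assms unfolding square_integrable_def by (intro borel_measurable_times) simp_all
    have "indicator {0..<1} \<in> borel_measurable mu"
      by (rule measurable_restrict_space1, rule borel_measurable_indicator) simp
    from borel_measurable_times[OF fg this]
    show "(\<lambda>u. f u * g u * indicator {0..<1} u) \<in> borel_measurable mu" .
    show "AE u in mu. f u * g u * indicator {0..<1} u = f u * g u"
      using AE_mu_neq[of 1] AE_space
      by eventually_elim (auto simp: space_restrict_space)
  qed
  finally show ?thesis .
qed

lemma AE_lebesgue_affine:
  fixes P :: "real \<Rightarrow> bool"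
  assumes "AE x in lebesgue. P x" "c \<noteq> 0"
  shows "AE x in lebesgue. P (t + c * x)"
proof -
  have m: "(\<lambda>x. t + c * x) \<in> lebesgue \<rightarrow>\<^sub>M lebesgue"
    using lebesgue_affine_measurable[of "\<lambda>_. c" t] assms(2) by simp
  have "AE x in density (distr lebesgue lebesgue (\<lambda>x. t + c * x)) (\<lambda>_. ennreal \<bar>c\<bar>). P x"
    using assms lebesgue_real_affine[of c t] by metis
  then have "AE x in distr lebesgue lebesgue (\<lambda>x. t + c * x). P x"
    using assms(2) by (simp add: AE_density)
  with m show ?thesis
    by (rule AE_distrD)
qed

lemma dilate_fun_eq:
  "dilate_fun k l f u =
    f (2 ^ k * u - (real l - 1)) * indicator {0..<1} (2 ^ k * u - (real l - 1))"
proof -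
  have "2 ^ k * (u - (real l - 1) / 2 ^ k) = 2 ^ k * u - (real l - 1)"
    unfolding right_diff_distrib by simp
  then show ?thesis
    using mem_cell_iff[of u l k] by (simp add: dilate_fun_def indicator_def)
qed

text \<open>Affine bijections preserve null sets, so the construction respects equality almost everywhere
  and descends to \<^typ>\<open>L2\<close>.\<close>

lemma AE_dilate_fun_cong:
  assumes "AE u in mu. f u = g u"
  shows "AE u in mu. dilate_fun k l f u = dilate_fun k l g u"
proof -
  have "AE u in lebesgue. u \<in> {0..1} \<longrightarrow> f u = g u"
    using assms by (subst (asm) AE_restrict_space_iff) auto
  from AE_lebesgue_affine[OF this, of "2 ^ k" "- (real l - 1)"]
  have "AE u in lebesgue. 2 ^ k * u - (real l - 1) \<in> {0..1} \<longrightarrow>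
      f (2 ^ k * u - (real l - 1)) = g (2 ^ k * u - (real l - 1))"
    by (simp add: add.commute[of _ "2 ^ k * _"] del: minus_diff_eq)
  then have "AE u in lebesgue. dilate_fun k l f u = dilate_fun k l g u"
    by (auto simp: dilate_fun_eq indicator_def elim!: eventually_mono)
  then show ?thesis
    by (subst AE_restrict_space_iff) auto
qed

lift_definition dilate :: "nat \<Rightarrow> nat \<Rightarrow> L2 \<Rightarrow> L2" is dilate_fun
  by (simp add: L2_rel_def square_integrable_dilate_fun AE_dilate_fun_cong)

lemma dilate_L2_class:
  "square_integrable f \<Longrightarrow> dilate k l (L2_class f) = L2_class (dilate_fun k l f)"
  by transfer (simp add: L2_rel_def square_integrable_dilate_fun)

lemma linear_dilate: "linear (dilate k l)"
proof (rule linearI)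
  fix f g :: L2 and c :: real
  have "dilate_fun k l (\<lambda>u. f u + g u) = (\<lambda>u. dilate_fun k l f u + dilate_fun k l g u)" for f g
    by (simp add: dilate_fun_def fun_eq_iff distrib_right)
  then show "dilate k l (f + g) = dilate k l f + dilate k l g"
    by transfer (simp add: L2_rel_def square_integrable_add square_integrable_dilate_fun)
  have "dilate_fun k l (\<lambda>u. c * f u) = (\<lambda>u. c * dilate_fun k l f u)" for f
    by (simp add: dilate_fun_def fun_eq_iff)
  then show "dilate k l (c *\<^sub>R f) = c *\<^sub>R dilate k l f"
    by transfer (simp add: L2_rel_def square_integrable_scale square_integrable_dilate_fun)
qed

lemma inner_dilate:
  "l \<in> {1..2 ^ k} \<Longrightarrow> inner (dilate k l f) (dilate k l g) = inner f g / 2 ^ k"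
  by transfer (simp add: L2_rel_def integral_dilate_fun_times)

lemma inner_dilate_disjoint:
  assumes "l \<noteq> l'"
  shows "inner (dilate k l f) (dilate k l' g) = 0"
proof -
  have *: "dilate_fun k l f u * dilate_fun k l' g u = 0" if "l \<noteq> l'" for k l l' f g u
  proof -
    have "real l + 1 \<le> real l' \<or> real l' + 1 \<le> real l"
      using that by linarith
    then show ?thesis
      by (auto simp: dilate_fun_eq indicator_def)
  qed
  show ?thesis
    using assms by transfer (simp add: *)
qed

text \<open>The two halves (\<open>m = 1\<close> and \<open>m = 2\<close>) of the \<open>l\<close>-th interval of level \<open>k\<close> are the intervals
  \<open>2 * l - 1\<close> and \<open>2 * l\<close> of the next level.\<close>

lemma dilate_dilate:
  assumes "l \<ge> 1" "m \<in> {1, 2}"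
  shows "dilate k l (dilate 1 m f) = dilate (Suc k) (2 * (l - 1) + m) f"
proof -
  have l: "real (2 * (l - 1) + m) = 2 * (real l - 1) + real m"
    using assms(1) by (simp add: of_nat_diff)
  have "dilate_fun k l (dilate_fun 1 m f) u = dilate_fun (Suc k) (2 * (l - 1) + m) f u" for f u
  proof -
    define v where "v = 2 ^ k * u - (real l - 1)"
    have arg: "2 ^ Suc k * u - (real (2 * (l - 1) + m) - 1) = 2 * v - (real m - 1)"
      unfolding l by (simp add: v_def)
    have sub: "v \<in> {0..<1}" if "2 * v - (real m - 1) \<in> {0..<1}"
      using assms(2) that by auto
    have "dilate_fun 1 m f v = f (2 * v - (real m - 1)) * indicator {0..<1} (2 * v - (real m - 1))"
      by (simp only: dilate_fun_eq power_one_right)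
    then show ?thesis
      unfolding dilate_fun_eq[of k] dilate_fun_eq[of "Suc k"] arg v_def[symmetric]
      using sub by (cases "2 * v - (real m - 1) \<in> {0..<1}") auto
  qed
  then have "dilate_fun k l (dilate_fun 1 m f) = dilate_fun (Suc k) (2 * (l - 1) + m) f" for f
    by (intro ext)
  then show ?thesis
    by transfer (simp add: L2_rel_def square_integrable_dilate_fun)
qed

section \<open>Truncated powers span the piecewise polynomials\<close>

definition trunc :: "nat \<Rightarrow> nat \<Rightarrow> nat \<Rightarrow> L2" where
  "trunc k l j = L2_class (\<lambda>u. tpow (u - (real l - 1) / 2 ^ k) j)"

lemma V_eq_span_trunc:
  "V q k = span (\<Union>l\<in>{1..2 ^ k}. trunc k l ` {..<q})"
proof -
  have "{L2_class (\<lambda>u. tpow (u - (real l - 1) / 2 ^ k) (j - 1)) | j l. j \<in> {1..q} \<and> l \<in> {1..2 ^ k}}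
      = {trunc k l (j - 1) | j l. j \<in> {1..q} \<and> l \<in> {1..2 ^ k}}"
    by (simp add: trunc_def)
  also have "\<dots> = (\<Union>l\<in>{1..2 ^ k}. trunc k l ` (\<lambda>j. j - 1) ` {1..q})"
    by blast
  also have "(\<lambda>j. j - 1) ` {1..q} = {..<q}"
    by (force simp: image_iff intro: bexI[of _ "Suc _"])
  finally show ?thesis
    by (simp only: V_def)
qed

lemma trunc_in_V: "l \<in> {1..2 ^ k} \<Longrightarrow> j < q \<Longrightarrow> trunc k l j \<in> V q k"
  unfolding V_eq_span_trunc by (rule span_base, rule UN_I[of l], assumption, simp)

lemma subspace_V: "subspace (V q k)"
  by (simp add: V_eq_span_trunc)

lemma tpow_eq: "tpow x n = (if x \<ge> 0 then x ^ n else 0)"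
  by (simp add: tpow_def max_def)

lemma trunc_last_eq_0: "trunc k (Suc (2 ^ k)) j = 0"
proof -
  have "AE u in mu. tpow (u - 1) j = 0"
    using AE_mu_neq[of 1] AE_space
    by eventually_elim (auto simp: space_restrict_space tpow_eq)
  then have "L2_class (\<lambda>u. tpow (u - 1) j) = L2_class (\<lambda>_. 0)"
    by (subst L2_class_eq_iff) (simp_all add: square_integrable_tpow)
  then show ?thesis
    by (simp add: trunc_def L2_class_zero)
qed

lemma trunc_0_1: "trunc 0 1 j = mon j"
proof -
  have "AE u in mu. tpow (u - 0) j = u ^ j"
    by (rule AE_I2) (simp add: space_restrict_space tpow_eq)
  then show ?thesis
    unfolding trunc_def mon_def
    by (subst L2_class_eq_iff)
      (simp_all add: square_integrable_power square_integrable_tpow[of 0, simplified])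
qed

text \<open>With \<open>a\<close> and \<open>b = a + 1 / 2 ^ k\<close> the end points of the \<open>l\<close>-th interval, the power
  \<open>(u - a) ^ j\<close> truncated at \<open>a\<close> splits into its restriction to \<open>[a, b)\<close>, which is a copy of a
  monomial, and its restriction to \<open>u \<ge> b\<close>. Expanding \<open>(u - b + 1 / 2 ^ k) ^ j\<close> shows the
  latter to be a combination of powers truncated at \<open>b\<close>.\<close>

lemma trunc_rec:
  assumes "l \<ge> 1"
  shows "trunc k l j = (1 / 2 ^ k) ^ j *\<^sub>R dilate k l (mon j) +
    (\<Sum>i\<le>j. (of_nat (j choose i) * (1 / 2 ^ k) ^ (j - i)) *\<^sub>R trunc k (Suc l) i)"
proof -
  define a where "a = (real l - 1) / 2 ^ k"
  define b where "b = real l / 2 ^ k"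
  have ab: "b - a = 1 / 2 ^ k" "a < b"
    by (simp_all add: a_def b_def diff_divide_distrib[symmetric] divide_strict_right_mono)
  have "0 \<le> a" "0 \<le> b" using assms by (simp_all add: a_def b_def)
  have pt: "tpow (u - a) j = (1 / 2 ^ k) ^ j * dilate_fun k l (\<lambda>u. u ^ j) u +
      (\<Sum>i\<le>j. of_nat (j choose i) * (1 / 2 ^ k) ^ (j - i) * tpow (u - b) i)" for u
  proof -
    have d: "(1 / 2 ^ k) ^ j * dilate_fun k l (\<lambda>u. u ^ j) u = (u - a) ^ j * indicator {a..<b} u"
      by (simp add: dilate_fun_def a_def b_def power_mult_distrib power_divide)
    show ?thesis
    proof (cases "u \<ge> b")
      case True
      have "(u - a) ^ j = ((u - b) + 1 / 2 ^ k) ^ j"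
        using ab(1) by (simp add: algebra_simps)
      also have "\<dots> = (\<Sum>i\<le>j. of_nat (j choose i) * (u - b) ^ i * (1 / 2 ^ k) ^ (j - i))"
        by (rule binomial_ring)
      finally show ?thesis
        unfolding d using True ab(2) by (simp add: tpow_eq mult_ac)
    next
      case False
      then show ?thesis
        unfolding d by (auto simp: tpow_eq indicator_def)
    qed
  qed
  have sq: "square_integrable (\<lambda>u. tpow (u - b) i)" for i
    by (rule square_integrable_tpow) fact
  have "trunc k l j = L2_class (\<lambda>u. (1 / 2 ^ k) ^ j * dilate_fun k l (\<lambda>u. u ^ j) u +
      (\<Sum>i\<le>j. of_nat (j choose i) * (1 / 2 ^ k) ^ (j - i) * tpow (u - b) i))"
    unfolding trunc_def a_def[symmetric] pt ..
  also have "\<dots> = (1 / 2 ^ k) ^ j *\<^sub>R L2_class (dilate_fun k l (\<lambda>u. u ^ j)) +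
      (\<Sum>i\<le>j. (of_nat (j choose i) * (1 / 2 ^ k) ^ (j - i)) *\<^sub>R L2_class (\<lambda>u. tpow (u - b) i))"
    by (simp add: L2_class_add L2_class_sum L2_class_scale square_integrable_scale sq
        square_integrable_sum square_integrable_dilate_fun square_integrable_power)
  also have "(\<lambda>i. L2_class (\<lambda>u. tpow (u - b) i)) = trunc k (Suc l)"
    by (simp add: trunc_def b_def fun_eq_iff)
  finally show ?thesis
    by (simp add: mon_def dilate_L2_class square_integrable_power fun_eq_iff trunc_def b_def)
qed

text \<open>Both inclusions come from \<open>trunc_rec\<close>. Solved for the copy, it expresses copies through
  truncated powers; read as a recursion running down from \<open>trunc k (2 ^ k + 1) j = 0\<close>, it
  expresses truncated powers through copies.\<close>

lemma V_eq_span_dilate: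
  "V q k = span (\<Union>l\<in>{1..2 ^ k}. dilate k l ` mon ` {..<q})" (is "_ = span ?D")
proof
  have "trunc k l j \<in> span ?D" if "l \<in> {1..2 ^ k}" "j < q" for l j
  proof -
    have "l \<le> Suc (2 ^ k)" using that by simp
    then show ?thesis
      using that(2) atLeastAtMost_iff[of l 1, THEN iffD1, OF that(1), THEN conjunct1]
    proof (induction l arbitrary: j rule: inc_induct)
      case base
      then show ?case by (simp add: trunc_last_eq_0 span_zero)
    next
      case (step n)
      have "dilate k n (mon j) \<in> span ?D"
        using step by (intro span_base UN_I[of n]) simp_all
      moreover have "trunc k (Suc n) i \<in> span ?D" if "i \<le> j" for i
        using step that by simp
      ultimately show ?case
        using step(4,5) by (subst trunc_rec) (auto intro!: span_add span_scale span_sum)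
    qed
  qed
  then show "V q k \<subseteq> span ?D"
    unfolding V_eq_span_trunc by (intro span_minimal) auto
next
  have "dilate k l (mon j) \<in> V q k" if l: "l \<in> {1..2 ^ k}" and j: "j < q" for l j
  proof -
    note V = subspace_V[of q k]
    have t: "trunc k l' i \<in> V q k" if "l' \<in> {1..Suc (2 ^ k)}" "i < q" for l' i
    proof (cases "l' = Suc (2 ^ k)")
      case True
      then show ?thesis using V by (simp add: trunc_last_eq_0 subspace_0)
    next
      case False
      then show ?thesis
        using that by (intro trunc_in_V) auto
    qed
    have "(1 / 2 ^ k) ^ j *\<^sub>R dilate k l (mon j) = trunc k l j -
        (\<Sum>i\<le>j. (of_nat (j choose i) * (1 / 2 ^ k) ^ (j - i)) *\<^sub>R trunc k (Suc l) i)"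
      using l by (subst trunc_rec) auto
    also have "\<dots> \<in> V q k"
      using l j by (intro subspace_diff subspace_sum subspace_scale V t) auto
    finally have "(2 ^ k) ^ j *\<^sub>R (1 / 2 ^ k) ^ j *\<^sub>R dilate k l (mon j) \<in> V q k"
      by (rule subspace_scale[OF V])
    then show ?thesis
      by (simp add: power_divide)
  qed
  then show "span ?D \<subseteq> V q k"
    by (intro span_minimal subspace_V) auto
qed

lemma dilate_in_V: "l \<in> {1..2 ^ k} \<Longrightarrow> j < q \<Longrightarrow> dilate k l (mon j) \<in> V q k"
  unfolding V_eq_span_dilate by (rule span_base, rule UN_I[of l], assumption, simp)

lemma V_0: "V q 0 = span (mon ` {..<q})"
proof -
  have "trunc 0 1 = mon"
    by (rule ext) (rule trunc_0_1)
  moreover have "{1..2 ^ 0} = {1 :: nat}"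
    by auto
  ultimately show ?thesis
    by (simp only: V_eq_span_trunc UN_insert UN_empty Un_empty_right)
qed

lemma V_mono_Suc: "V q k \<subseteq> V q (Suc k)"
proof -
  have "trunc k l j \<in> V q (Suc k)" if "l \<in> {1..2 ^ k}" "j < q" for l j
  proof -
    have "(real l - 1) / 2 ^ k = (real (2 * l - 1) - 1) / 2 ^ Suc k"
      using that by (simp add: of_nat_diff field_simps)
    then have "trunc k l j = trunc (Suc k) (2 * l - 1) j"
      by (simp only: trunc_def)
    also have "\<dots> \<in> V q (Suc k)"
      using that by (intro trunc_in_V) auto
    finally show ?thesis .
  qed
  then show ?thesis
    unfolding V_eq_span_trunc[of q k] by (intro span_minimal subspace_V) auto
qed

lemma V_mono: "k \<le> k' \<Longrightarrow> V q k \<subseteq> V q k'"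
  using lift_Suc_mono_le[of "V q", OF V_mono_Suc] .

section \<open>Refining the grid\<close>

lemma dilate_V_1:
  assumes "x \<in> V q 1" "l \<in> {1..2 ^ k}"
  shows "dilate k l x \<in> V q (Suc k)"
proof -
  have "dilate k l ` (\<Union>m\<in>{1..2 ^ 1}. dilate 1 m ` mon ` {..<q}) \<subseteq> V q (Suc k)"
  proof safe
    fix m j :: nat assume m: "m \<in> {1..2 ^ 1}" and j: "j < q"
    have "dilate k l (dilate 1 m (mon j)) = dilate (Suc k) (2 * (l - 1) + m) (mon j)"
      using assms(2) m by (intro dilate_dilate) auto
    moreover have "2 * (l - 1) + m \<in> {1..2 ^ Suc k}"
      using assms(2) m by auto
    ultimately show "dilate k l (dilate 1 m (mon j)) \<in> V q (Suc k)"
      using j by (simp only: dilate_in_V)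
  qed
  then have "span (dilate k l ` (\<Union>m\<in>{1..2 ^ 1}. dilate 1 m ` mon ` {..<q})) \<subseteq> V q (Suc k)"
    by (rule span_minimal[OF _ subspace_V])
  then show ?thesis
    using assms(1) unfolding linear_span_image[OF linear_dilate] V_eq_span_dilate[of q 1] by blast
qed

text \<open>One refinement step, from the coarsest level to all levels: an interval of level \<open>k + 1\<close> is a
  half of some interval \<open>l\<close> of level \<open>k\<close>, so a copy of a monomial on it is \<open>dilate k l\<close> of an
  element of \<open>V q 1\<close>. Writing that element through monomials and \<open>\<Psi>\<close> gives elements of \<open>V q k\<close>
  and copies of \<open>\<Psi>\<close>.\<close>

lemma V_Suc:
  assumes V1: "V q 1 = span (mon ` {..<q} \<union> \<Psi>)"
  shows "V q (Suc k) = span (V q k \<union> (\<Union>l\<in>{1..2 ^ k}. dilate k l ` \<Psi>))" (is "_ = span ?S")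
proof
  have *: "dilate k l x \<in> span ?S" if "x \<in> V q 1" "l \<in> {1..2 ^ k}" for x l
  proof -
    have "dilate k l ` (mon ` {..<q} \<union> \<Psi>) \<subseteq> ?S"
      using that(2) unfolding V_eq_span_dilate by (auto intro!: span_base)
    then have "dilate k l ` span (mon ` {..<q} \<union> \<Psi>) \<subseteq> span ?S"
      unfolding linear_span_image[OF linear_dilate, symmetric] by (rule span_mono)
    then show ?thesis using that(1) V1 by blast
  qed
  have "dilate (Suc k) l (mon j) \<in> span ?S" if l: "l \<in> {1..2 ^ Suc k}" and j: "j < q" for l j
  proof -
    \<comment> \<open>\<open>l'\<close> is the parent interval and \<open>m\<close> tells which half of it is meant.\<close>
    define l' where "l' = (l + 1) div 2"
    define m where "m = l - 2 * (l' - 1)"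
    have lm: "l' \<in> {1..2 ^ k}" "m \<in> {1, 2}" "l = 2 * (l' - 1) + m"
      using l by (auto simp: l'_def m_def)
    have "dilate 1 m (mon j) \<in> V q 1"
      using lm(2) j by (intro dilate_in_V) auto
    with lm show ?thesis
      using *[of "dilate 1 m (mon j)" l'] dilate_dilate[of l' m k "mon j"] by simp
  qed
  then show "V q (Suc k) \<subseteq> span ?S"
    unfolding V_eq_span_dilate[of q "Suc k"] by (intro span_minimal) auto
next
  have "\<Psi> \<subseteq> V q 1"
    unfolding V1 using span_superset by blast
  then have "?S \<subseteq> V q (Suc k)"
    using V_mono_Suc dilate_V_1 by blast
  then show "span ?S \<subseteq> V q (Suc k)"
    by (rule span_minimal[OF _ subspace_V])
qed

text \<open>It suffices to test against copies of monomials. Those on other intervals are orthogonal by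
  disjointness of supports; the one on the interval \<open>l\<close> by scaling.\<close>

lemma inner_V_dilate:
  assumes "\<And>j. j < q \<Longrightarrow> inner (mon j) \<psi> = 0" "l \<in> {1..2 ^ k}" "x \<in> V q k"
  shows "inner x (dilate k l \<psi>) = 0"
  using assms(3) unfolding V_eq_span_dilate
proof (induction rule: span_induct)
  case base
  show ?case
    by (rule subspaceI) (simp_all add: inner_add_left)
next
  case (step x)
  then obtain l' j where "l' \<in> {1..2 ^ k}" "j < q" "x = dilate k l' (mon j)" by auto
  then show ?case
    using assms(1,2) by (cases "l' = l") (auto simp: inner_dilate inner_dilate_disjoint)
qed


section \<open>The blocks\<close>

lemma set_vec_eq: "set\<^sub>v F = ($) F ` {..<dim_vec F}"
  by (auto simp: vec_set_def)

lemma L2_class_B0: "j < q \<Longrightarrow> L2_class (B0 q $ j) = mon j"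
  by (simp add: B0_def mon_def)

lemma L2_class_Bkl:
  assumes "A1 \<in> carrier_mat q q" "A2 \<in> carrier_mat q q" "j < q"
  shows "L2_class (Bkl q A1 A2 (Suc k) l $ j) = dilate k l (L2_class (B1 q A1 A2 $ j))"
proof -
  have "Bkl q A1 A2 (Suc k) l $ j = dilate_fun k l (B1 q A1 A2 $ j)"
    using assms(3) by (simp add: Bkl_def dilate_fun_def fun_eq_iff)
  then show ?thesis
    using assms by (simp add: dilate_L2_class square_integrable_B1)
qed

lemma L2_class_B1_in_V_1:
  assumes "A1 \<in> carrier_mat q q" "A2 \<in> carrier_mat q q" "j < q"
  shows "L2_class (B1 q A1 A2 $ j) \<in> V q 1"
proof -
  \<comment> \<open>Restrictions of monomials to the left half come from \<open>dilate 1 1\<close>; those to the right half are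
    differences, which avoids shifting monomials.\<close>
  have left: "dilate 1 1 (mon i) \<in> V q 1" if "i < q" for i
    by (rule dilate_in_V) (use that in auto)
  have "V q 0 \<subseteq> V q 1" by (rule V_mono) simp
  then have m: "mon i \<in> V q 1" if "i < q" for i
    using that span_base[of "mon i" "mon ` {..<q}"] unfolding V_0 by auto
  have "L2_class (B1 q A1 A2 $ j) =
      (\<Sum>i<q. (A1 $$ (i, j) / 2 ^ i) *\<^sub>R dilate 1 1 (mon i)) +
      (\<Sum>i<q. A2 $$ (i, j) *\<^sub>R (mon i - (1 / 2 ^ i) *\<^sub>R dilate 1 1 (mon i)))"
    (is "_ = ?r")
  proof -
    have d: "dilate_fun 1 1 (\<lambda>u. u ^ i) u = 2 ^ i * (u ^ i * indicator {0..<1/2} u)" for i u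
      by (simp add: dilate_fun_def power_mult_distrib)
    have sq: "square_integrable (\<lambda>u. c * (u ^ i * indicator {0..<1/2} u))" for c i
      using square_integrable_scale[OF square_integrable_dilate_fun[OF square_integrable_power[of i],
          of 1 1], of "c / 2 ^ i"] unfolding d by simp
    have half: "L2_class (\<lambda>u. u ^ i * indicator {0..<1/2} u) =
        (1 / 2 ^ i) *\<^sub>R dilate 1 1 (mon i)" for i
      unfolding mon_def dilate_L2_class[OF square_integrable_power] d
      using sq[of 1, simplified] by (simp add: L2_class_scale)
    have "AE u in mu. (B1 q A1 A2 $ j) u =
        (\<Sum>i<q. A1 $$ (i, j) * (u ^ i * indicator {0..<1/2} u)) +
        (\<Sum>i<q. A2 $$ (i, j) * (u ^ i + - 1 * (u ^ i * indicator {0..<1/2} u)))"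
    proof (rule AE_I2)
      fix u assume "u \<in> space mu"
      then have u: "u \<in> {0..1}" by (simp add: space_restrict_space)
      show "(B1 q A1 A2 $ j) u =
        (\<Sum>i<q. A1 $$ (i, j) * (u ^ i * indicator {0..<1/2} u)) +
        (\<Sum>i<q. A2 $$ (i, j) * (u ^ i + - 1 * (u ^ i * indicator {0..<1/2} u)))"
        using assms u by (cases "u < 1/2") (auto simp: B1_def block_mult_B0 mult.commute)
    qed
    then have "L2_class (B1 q A1 A2 $ j) = L2_class (\<lambda>u.
        (\<Sum>i<q. A1 $$ (i, j) * (u ^ i * indicator {0..<1/2} u)) +
        (\<Sum>i<q. A2 $$ (i, j) * (u ^ i + - 1 * (u ^ i * indicator {0..<1/2} u))))"
      using assms
      by (subst L2_class_eq_iff) (intro square_integrable_B1 square_integrable_add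
          square_integrable_sum square_integrable_scale square_integrable_power sq
          sq[of 1, simplified] | simp)+
    also have "\<dots> =
        (\<Sum>i<q. A1 $$ (i, j) *\<^sub>R L2_class (\<lambda>u. u ^ i * indicator {0..<1/2} u)) +
        (\<Sum>i<q. A2 $$ (i, j) *\<^sub>R
          (mon i + (- 1) *\<^sub>R L2_class (\<lambda>u. u ^ i * indicator {0..<1/2} u)))"
      unfolding mon_def using sq[of 1, simplified]
      by (simp only: L2_class_add L2_class_sum L2_class_scale square_integrable_scale
          square_integrable_add square_integrable_sum square_integrable_power)
    finally show ?thesis
      unfolding half by simp
  qed
  also have "?r \<in> V q 1"
    by (intro subspace_add subspace_sum subspace_scale subspace_diff subspace_V left m) auto
  finally show ?thesis .
qed

text \<open>Orthogonality makes the monomials and \<open>\<psi>\<close> jointly independent. They are \<open>2 * q\<close> in number, and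
  \<open>V q 1\<close> is spanned by the \<open>2 * q\<close> copies of monomials on the two halves of \<open>[0, 1]\<close>.\<close>

lemma V_1_eq_span:
  fixes \<psi> :: "nat \<Rightarrow> L2"
  assumes "\<And>j. j < q \<Longrightarrow> \<psi> j \<in> V q 1" "inj_on \<psi> {..<q}" "independent (\<psi> ` {..<q})"
    and "\<And>i j. i < q \<Longrightarrow> j < q \<Longrightarrow> inner (mon i) (\<psi> j) = 0"
  shows "V q 1 = span (mon ` {..<q} \<union> \<psi> ` {..<q})"
proof -
  have eq: "V q 1 = span (dilate 1 1 ` mon ` {..<q} \<union> dilate 1 2 ` mon ` {..<q})"
  proof -
    have "{1..2 ^ 1} = {1, 2 :: nat}" by auto
    then show ?thesis
      by (simp only: V_eq_span_dilate UN_insert UN_empty Un_empty_right)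
  qed
  have "independent (mon ` {..<q} \<union> \<psi> ` {..<q})" "mon ` {..<q} \<inter> \<psi> ` {..<q} = {}"
    by (rule independent_orthogonal_Un; use assms independent_monom in auto)+
  moreover have "mon ` {..<q} \<union> \<psi> ` {..<q} \<subseteq> V q 1"
    using assms(1) V_mono[of 0 1 q] span_superset unfolding V_0 by fastforce
  moreover have "card (dilate 1 1 ` mon ` {..<q} \<union> dilate 1 2 ` mon ` {..<q}) \<le> q + q"
    by (rule order.trans[OF card_Un_le]; intro add_mono)
      (use card_image_le[of "{..<q}"] in \<open>simp_all add: image_image\<close>)
  ultimately show ?thesis
    unfolding eq
    by (intro span_eq_if_independent_card_ge[symmetric])
      (simp_all add: card_Un_disjoint card_image assms(2) inj_on_monom)
qed

lemma span_span_Un: "span (span S \<union> T) = span (S \<union> T)"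
  by (simp add: span_Un span_span)

lemma V_eq_span_wavelets:
  assumes V1: "V q 1 = span (mon ` {..<q} \<union> \<Psi>)"
  shows "V q k = span (mon ` {..<q} \<union> (\<Union>k'<k. \<Union>l\<in>{1..2 ^ k'}. dilate k' l ` \<Psi>))"
proof (induction k)
  case 0
  then show ?case by (simp add: V_0)
next
  case (Suc k)
  then show ?case
    unfolding V_Suc[OF V1, of k] Suc.IH span_span_Un lessThan_Suc UN_insert
    by (simp only: Un_ac)
qed

theorem lemma6p2:
  fixes q :: nat and A1 A2 :: "real mat"
  assumes "q \<ge> 1"
    and "A1 \<in> carrier_mat q q" and "A2 \<in> carrier_mat q q"
    and "gram (B1 q A1 A2) (B0 q) = 0\<^sub>m q q"
    and "lin_indep_block (B1 q A1 A2)"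
  shows "(\<forall>k\<ge>1. \<forall>l\<in>{1..2 ^ (k - 1)}. gram (B0 q) (Bkl q A1 A2 k l) = 0\<^sub>m q q)
    \<and> (\<forall>k1\<ge>1. \<forall>k2\<ge>1. k1 \<noteq> k2 \<longrightarrow>
        (\<forall>l1\<in>{1..2 ^ (k1 - 1)}. \<forall>l2\<in>{1..2 ^ (k2 - 1)}.
          gram (Bkl q A1 A2 k1 l1) (Bkl q A1 A2 k2 l2) = 0\<^sub>m q q))
    \<and> V q 0 = block_span {B0 q}
    \<and> (\<forall>k\<ge>1. V q k =
        block_span ({B0 q} \<union> {Bkl q A1 A2 k' l' | k' l'. k' \<in> {1..k} \<and> l' \<in> {1..2 ^ (k' - 1)}}))"
proof -
  note A = assms(2,3)
  define \<psi> where "\<psi> j = L2_class (B1 q A1 A2 $ j)" for j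
  define B where "B k l j = L2_class (Bkl q A1 A2 k l $ j)" for k l j
  have dim: "dim_vec (B0 q) = q" "dim_vec (B1 q A1 A2) = q" "dim_vec (Bkl q A1 A2 k l) = q" for k l
    by (simp_all add: B0_def B1_def Bkl_def)
  have B_eq: "B (Suc k) l j = dilate k l (\<psi> j)" if "j < q" for k l j
    unfolding B_def \<psi>_def by (rule L2_class_Bkl[OF A that])
  have orth: "inner (mon i) (\<psi> j) = 0" if "i < q" "j < q" for i j
  proof -
    have "inner (\<psi> j) (mon i) = gram (B1 q A1 A2) (B0 q) $$ (j, i)"
      unfolding \<psi>_def L2_class_B0[OF that(1), symmetric]
      using that A by (simp add: gram_def dim inner_L2_class square_integrable_B1 square_integrable_B0)
    then show ?thesis
      unfolding assms(4) using that by (simp add: inner_commute)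
  qed
  have \<psi>: "\<psi> j \<in> V q 1" if "j < q" for j
    unfolding \<psi>_def by (rule L2_class_B1_in_V_1[OF A that])
  have "inj_on \<psi> {..<q}" "independent (\<psi> ` {..<q})"
    using assms(5) unfolding lin_indep_block_def set_vec_eq dim image_image \<psi>_def by auto
  with orth \<psi> have V1: "V q 1 = span (mon ` {..<q} \<union> \<psi> ` {..<q})"
    by (intro V_1_eq_span)
  \<comment> \<open>Blocks of level \<open>k + 1\<close> lie in \<open>V q (k + 1)\<close> and are orthogonal to \<open>V q k\<close>. All orthogonality
    relations follow from these two facts and the monotonicity of \<open>V q\<close>.\<close>
  have B_V: "B (Suc k) l j \<in> V q (Suc k)" if "l \<in> {1..2 ^ k}" "j < q" for k l j
    unfolding B_eq[OF that(2)] using \<psi> that by (intro dilate_V_1) auto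
  have B_orth: "inner x (B (Suc k) l j) = 0" if "l \<in> {1..2 ^ k}" "j < q" "x \<in> V q k" for x k l j
    unfolding B_eq[OF that(2)] using that orth by (intro inner_V_dilate[where q = q]) auto
  have g0: "gram (B0 q) (Bkl q A1 A2 (Suc k) l) = 0\<^sub>m q q" if "l \<in> {1..2 ^ k}" for k l
  proof (rule eq_matI)
    fix i j assume "i < dim_row (0\<^sub>m q q :: real mat)" "j < dim_col (0\<^sub>m q q :: real mat)"
    then have ij: "i < q" "j < q" by simp_all
    have "mon i \<in> V q k"
      using V_mono[of 0 k q] ij span_base[of "mon i" "mon ` {..<q}"] unfolding V_0 by auto
    then have "inner (L2_class (B0 q $ i)) (B (Suc k) l j) = 0"
      using that ij by (simp add: L2_class_B0 B_orth)
    then show "gram (B0 q) (Bkl q A1 A2 (Suc k) l) $$ (i, j) = 0\<^sub>m q q $$ (i, j)"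
      using ij A by (simp add: gram_def dim B_def inner_L2_class square_integrable_B0 square_integrable_Bkl)
  qed (simp_all add: gram_def dim)
  have inner_BB: "inner (B (Suc k1) l1 i) (B (Suc k2) l2 j) = 0"
    if "k1 < k2" "l1 \<in> {1..2 ^ k1}" "l2 \<in> {1..2 ^ k2}" "i < q" "j < q" for k1 k2 l1 l2 i j
    using B_V[OF that(2,4)] V_mono[of "Suc k1" k2 q] that by (intro B_orth) auto
  have gB: "gram (Bkl q A1 A2 (Suc k1) l1) (Bkl q A1 A2 (Suc k2) l2) = 0\<^sub>m q q"
    if "k1 \<noteq> k2" "l1 \<in> {1..2 ^ k1}" "l2 \<in> {1..2 ^ k2}" for k1 k2 l1 l2
  proof (rule eq_matI)
    fix i j assume "i < dim_row (0\<^sub>m q q :: real mat)" "j < dim_col (0\<^sub>m q q :: real mat)"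
    then have ij: "i < q" "j < q" by simp_all
    have "inner (B (Suc k1) l1 i) (B (Suc k2) l2 j) = 0"
      using that ij inner_BB[of k1 k2 l1 l2 i j] inner_BB[of k2 k1 l2 l1 j i]
      by (cases "k1 < k2") (auto simp: inner_commute)
    then show "gram (Bkl q A1 A2 (Suc k1) l1) (Bkl q A1 A2 (Suc k2) l2) $$ (i, j) = 0\<^sub>m q q $$ (i, j)"
      using ij A by (simp add: gram_def dim B_def inner_L2_class square_integrable_Bkl)
  qed (simp_all add: gram_def dim)
  have set_B0: "L2_class ` set\<^sub>v (B0 q) = mon ` {..<q}"
    unfolding set_vec_eq dim image_image by (intro image_cong refl) (simp add: L2_class_B0)
  have set_B: "L2_class ` set\<^sub>v (Bkl q A1 A2 (Suc k) l) = dilate k l ` \<psi> ` {..<q}" for k l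
    unfolding set_vec_eq dim image_image
    by (intro image_cong refl) (simp add: B_eq flip: B_def)
  have span_B: "V q k =
      block_span ({B0 q} \<union> {Bkl q A1 A2 k' l' | k' l'. k' \<in> {1..k} \<and> l' \<in> {1..2 ^ (k' - 1)}})" for k
  proof -
    have Suc: "{1..k} = Suc ` {..<k}"
      by (simp add: lessThan_atLeast0 image_Suc_atLeastLessThan atLeastLessThanSuc_atLeastAtMost)
    have "{Bkl q A1 A2 k' l' | k' l'. k' \<in> {1..k} \<and> l' \<in> {1..2 ^ (k' - 1)}} =
        (\<Union>k'\<in>{1..k}. Bkl q A1 A2 k' ` {1..2 ^ (k' - 1)})"
      by blast
    also have "\<dots> = (\<Union>k'<k. Bkl q A1 A2 (Suc k') ` {1..2 ^ k'})"
      unfolding Suc by simp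
    finally show ?thesis
      unfolding block_span_def V_eq_span_wavelets[OF V1, of k]
      by (simp add: set_B0 set_B)
  qed
  show ?thesis
  proof (intro conjI allI impI ballI)
    show "gram (B0 q) (Bkl q A1 A2 k l) = 0\<^sub>m q q" if "1 \<le> k" "l \<in> {1..2 ^ (k - 1)}" for k l
      using g0[of l "k - 1"] that by simp
    show "gram (Bkl q A1 A2 k1 l1) (Bkl q A1 A2 k2 l2) = 0\<^sub>m q q"
      if "1 \<le> k1" "1 \<le> k2" "k1 \<noteq> k2" "l1 \<in> {1..2 ^ (k1 - 1)}" "l2 \<in> {1..2 ^ (k2 - 1)}"
      for k1 k2 l1 l2
      using gB[of "k1 - 1" "k2 - 1" l1 l2] that by simp
    show "V q 0 = block_span {B0 q}"
      by (simp add: block_span_def set_B0 V_0)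
    show "V q k =
        block_span ({B0 q} \<union> {Bkl q A1 A2 k' l' | k' l'. k' \<in> {1..k} \<and> l' \<in> {1..2 ^ (k' - 1)}})" for k
      by (rule span_B)
  qed
qed

end
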